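(* Let $1\le k\le d$ be integers and let $\eta=(\eta(1),\dots,\eta(k))\in\mathbb{Z}_2^k$. Then, uniformly in $t>0$ and $x,y\in\mathbb{R}_{+,k}=\mathbb{R}^{d-k}\times(0,\infty)^k$, $$ p_t^{\eta,\mathbb{R}_{+,k}}(x,y)\simeq p_t^{(d)}(x-y)\prod_{j\in d-k+J_\eta}\frac{x_jy_j}{x_jy_j+t}, $$ where $J_\eta=\{1\le j\le k\colon \eta(j)=1\}$ and $d-k+J_\eta=\{d-k+i\colon i\in J_\eta\}$.
   Context: $p_t^{(d)}(w)=(4\pi t)^{-d/2}\exp(-\|w\|^2/4t)$, $w\in\mathbb{R}^d$, is the Gauss-Weierstrass kernel. The set $R_k=\{\pm e_{d-k+1},\dots,\pm e_d\}\subset\mathbb{R}^d$ is an orthogonal root system. Its reflection group $W(R_k)$ is identified with $\widehat{\mathbb{Z}}_2^k$, $\widehat{\mathbb{Z}}_2=\{1,-1\}$ with multiplication, acting on $\mathbb{R}^d$ by $\varepsilon x=(x_1,\dots,x_{d-k},\varepsilon_1x_{d-k+1},\dots,\varepsilon_kx_d)$ for $\varepsilon=(\varepsilon_1,\dots,\varepsilon_k)$. The distinguished Weyl chamber is $\mathbb{R}_{+,k}=\mathbb{R}^{d-k}\times(0,\infty)^k$. Homomorphisms from $\widehat{\mathbb{Z}}_2^k$ to $\widehat{\mathbb{Z}}_2$ are identified with elements $\eta\in\mathbb{Z}_2^k$, $\mathbb{Z}_2=\{0,1\}$ with addition modulo 2, via $\varepsilon\mapsto\varepsilon^\eta=\prod_{j=1}^k\varepsilon_j^{\eta(j)}$.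 The kernel $p_t^{\eta,\mathbb{R}_{+,k}}$ is the heat kernel on $\mathbb{R}_{+,k}$ of the Laplacian with Dirichlet condition on the facets $\{x_{d-k+j}=0\}$ with $\eta(j)=1$ and Neumann condition on the facets $\{x_{d-k+j}=0\}$ with $\eta(j)=0$; it is given, for $x,y\in\mathbb{R}_{+,k}$ and $t>0$, by $$p_t^{\eta,\mathbb{R}_{+,k}}(x,y)=\sum_{\varepsilon\in\widehat{\mathbb{Z}}_2^k}\varepsilon^\eta\,p_t^{(d)}(\varepsilon x-y).$$ $X\simeq Y$ uniformly in the indicated variables means that there is a constant $C>0$, independent of these variables $t,x,y$, with $C^{-1}Y\le X\le CY$. An empty product equals $1$. *)

theory Defs
  imports "HOL-Analysis.Analysis" "HOL-Library.FuncSet"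
begin

text \<open>
  The dimension \<open>d\<close> is a term-level parameter and \<open>d - k\<close> may be \<open>0\<close>, so a vector of
  \<open>\<real>\<^sup>d\<close> is a function in \<open>{1..d} \<rightarrow>\<^sub>E UNIV\<close>; its coordinates are numbered from \<open>1\<close>.
\<close>

definition euclid :: "nat \<Rightarrow> (nat \<Rightarrow> real) set" where
  "euclid d = ({1..d} \<rightarrow>\<^sub>E UNIV)"

definition vec_diff :: "nat \<Rightarrow> (nat \<Rightarrow> real) \<Rightarrow> (nat \<Rightarrow> real) \<Rightarrow> (nat \<Rightarrow> real)" where
  "vec_diff d x y = (\<lambda>i\<in>{1..d}. x i - y i)"

definition gauss_kernel :: "nat \<Rightarrow> real \<Rightarrow> (nat \<Rightarrow> real) \<Rightarrow> real" where
  "gauss_kernel d t w =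
     (4 * pi * t) powr (- real d / 2) * exp (- (L2_set w {1..d})\<^sup>2 / (4 * t))"

definition chamber :: "nat \<Rightarrow> nat \<Rightarrow> (nat \<Rightarrow> real) set" where
  "chamber d k = {x \<in> euclid d. \<forall>j\<in>{1..k}. 0 < x (d - k + j)}"

definition sign_group :: "nat \<Rightarrow> (nat \<Rightarrow> real) set" where
  "sign_group k = ({1..k} \<rightarrow>\<^sub>E {1, - 1})"

definition sign_act :: "nat \<Rightarrow> nat \<Rightarrow> (nat \<Rightarrow> real) \<Rightarrow> (nat \<Rightarrow> real) \<Rightarrow> (nat \<Rightarrow> real)" where
  "sign_act d k \<epsilon> x = (\<lambda>i\<in>{1..d}. if i \<le> d - k then x i else \<epsilon> (i - (d - k)) * x i)"

text \<open>
  Elements of \<open>\<int>\<^sub>2\<^sup>k\<close> are represented by their representatives in \<open>{0, 1}\<close>, which serve as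
  exponents; the group structure of \<open>\<int>\<^sub>2\<^sup>k\<close> is not needed.
\<close>

definition Z2_pow :: "nat \<Rightarrow> (nat \<Rightarrow> nat) set" where
  "Z2_pow k = ({1..k} \<rightarrow>\<^sub>E {0, 1})"

definition sign_char :: "nat \<Rightarrow> (nat \<Rightarrow> nat) \<Rightarrow> (nat \<Rightarrow> real) \<Rightarrow> real" where
  "sign_char k \<eta> \<epsilon> = (\<Prod>j\<in>{1..k}. \<epsilon> j ^ \<eta> j)"

text \<open>
  The heat kernel on the chamber with Dirichlet condition on the facets with \<open>\<eta> j = 1\<close> and Neumann
  condition on those with \<open>\<eta> j = 0\<close>, given by the explicit reflection formula.
\<close>

definition chamber_kernel ::
    "nat \<Rightarrow> nat \<Rightarrow> (nat \<Rightarrow> nat) \<Rightarrow> real \<Rightarrow> (nat \<Rightarrow> real) \<Rightarrow> (nat \<Rightarrow> real) \<Rightarrow> real" where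
  "chamber_kernel d k \<eta> t x y =
     (\<Sum>\<epsilon>\<in>sign_group k. sign_char k \<eta> \<epsilon> * gauss_kernel d t (vec_diff d (sign_act d k \<epsilon> x) y))"

definition J_set :: "nat \<Rightarrow> (nat \<Rightarrow> nat) \<Rightarrow> nat set" where
  "J_set k \<eta> = {j \<in> {1..k}. \<eta> j = 1}"

end

theory Submission
  imports Defs
begin

text \<open>
  Flipping the sign of one coordinate changes the squared distance by a multiple of a single product:
  \<open>(- a - b)\<^sup>2 = (a - b)\<^sup>2 + 4 a b\<close>. Hence every term of the reflection sum is the free Gaussian
  \<open>p\<^sub>t(x - y)\<close> times a product over the last \<open>k\<close> coordinates \<open>j\<close> of factors \<open>1\<close> or \<open>exp (- x\<^sub>j y\<^sub>j / t)\<close>, one for each sign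
  (\<open>gauss_kernel_sign_act\<close>). The character is a product over the same coordinates, so the sum over
  the sign group is the expansion of a product, and the chamber kernel is exactly the free Gaussian
  times \<open>\<Prod>\<^sub>j (1 \<plusminus> exp (- x\<^sub>j y\<^sub>j / t))\<close>, with a minus sign at the Dirichlet coordinates and a plus
  sign at the Neumann ones (\<open>chamber_kernel_factorization\<close>).

  It remains to compare each factor: \<open>1 + exp (- u)\<close> lies between \<open>1\<close> and \<open>2\<close>, and
  \<open>1 - exp (- u)\<close> lies between \<open>u / (u + 1)\<close> and twice that, for every \<open>u \<ge> 0\<close>. With \<open>u = x\<^sub>j y\<^sub>j / t\<close>
  the quotient becomes \<open>x\<^sub>j y\<^sub>j / (x\<^sub>j y\<^sub>j + t)\<close>. Multiplying over the \<open>k\<close> coordinates gives the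
  two-sided bound, with the constant \<open>2 ^ k\<close>.
\<close>

text \<open>
  The identity \<open>(e a - b)\<^sup>2 = (a - b)\<^sup>2 + 2 (1 - e) a b\<close> for \<open>e\<^sup>2 = 1\<close> gives the factors for
  both signs in one formula, and this formula depends on \<open>\<epsilon>\<close> coordinatewise, as the expansion of a
  product over the sign group requires.
\<close>

lemma gauss_kernel_sign_act:
  assumes "k \<le> d" and "\<epsilon> \<in> sign_group k"
  shows "gauss_kernel d t (vec_diff d (sign_act d k \<epsilon> x) y) =
    gauss_kernel d t (vec_diff d x y) *
      (\<Prod>j\<in>{1..k}. exp (- ((1 - \<epsilon> j) * (x (d - k + j) * y (d - k + j)) / (2 * t))))"
proof -
  define g where "g j = 2 * (1 - \<epsilon> j) * (x (d - k + j) * y (d - k + j))" for j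
  have sq: "(vec_diff d (sign_act d k \<epsilon> x) y i)\<^sup>2 =
      (vec_diff d x y i)\<^sup>2 + (if i \<le> d - k then 0 else g (i - (d - k)))"
    if i: "i \<in> {1..d}" for i
  proof (cases "i \<le> d - k")
    case True
    then show ?thesis using i by (simp add: vec_diff_def sign_act_def)
  next
    case False
    then have "i - (d - k) \<in> {1..k}" using i assms(1) by auto
    then have "\<epsilon> (i - (d - k)) \<in> {1, - 1}"
      using assms(2) unfolding sign_group_def by (rule PiE_mem[rotated])
    then have "\<epsilon> (i - (d - k)) = 1 \<or> \<epsilon> (i - (d - k)) = - 1" by simp
    then show ?thesis
      using False i
      by (elim disjE) (simp_all add: vec_diff_def sign_act_def g_def power2_eq_square algebra_simps)
  qed
  have "(\<Sum>i\<in>{1..d}. if i \<le> d - k then 0 else g (i - (d - k))) =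
      (\<Sum>i\<in>{d - k + 1..d}. g (i - (d - k)))"
    by (rule sum.mono_neutral_cong_right) auto
  also have "\<dots> = (\<Sum>j\<in>{1..k}. g j)"
    by (rule sum.reindex_bij_witness[where i = "\<lambda>j. d - k + j" and j = "\<lambda>i. i - (d - k)"])
      (use assms(1) in auto)
  finally have tail: "(\<Sum>i\<in>{1..d}. if i \<le> d - k then 0 else g (i - (d - k))) = (\<Sum>j\<in>{1..k}. g j)" .
  have "(L2_set (vec_diff d (sign_act d k \<epsilon> x) y) {1..d})\<^sup>2 =
      (\<Sum>i\<in>{1..d}. (vec_diff d (sign_act d k \<epsilon> x) y i)\<^sup>2)"
    by (simp add: L2_set_def sum_nonneg)
  also have "\<dots> = (\<Sum>i\<in>{1..d}. (vec_diff d x y i)\<^sup>2 + (if i \<le> d - k then 0 else g (i - (d - k))))"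
    by (rule sum.cong[OF refl sq])
  also have "\<dots> = (L2_set (vec_diff d x y) {1..d})\<^sup>2 + (\<Sum>j\<in>{1..k}. g j)"
    unfolding sum.distrib tail by (simp add: L2_set_def sum_nonneg)
  finally have norm: "(L2_set (vec_diff d (sign_act d k \<epsilon> x) y) {1..d})\<^sup>2 =
      (L2_set (vec_diff d x y) {1..d})\<^sup>2 + (\<Sum>j\<in>{1..k}. g j)" .
  have quot: "(1 - \<epsilon> j) * (x (d - k + j) * y (d - k + j)) / (2 * t) = g j / (4 * t)" for j
    by (cases "t = 0") (simp_all add: g_def field_simps)
  have "(\<Prod>j\<in>{1..k}. exp (- ((1 - \<epsilon> j) * (x (d - k + j) * y (d - k + j)) / (2 * t)))) =
      exp (\<Sum>j\<in>{1..k}. - (g j / (4 * t)))"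
    by (simp add: exp_sum quot)
  also have "\<dots> = exp (- (\<Sum>j\<in>{1..k}. g j) / (4 * t))"
    by (simp add: sum_negf sum_divide_distrib)
  finally show ?thesis
    unfolding gauss_kernel_def norm
    by (simp add: add_divide_distrib diff_divide_distrib flip: exp_add)
qed

lemma chamber_kernel_factorization:
  assumes "k \<le> d"
  shows "chamber_kernel d k \<eta> t x y = gauss_kernel d t (vec_diff d x y) *
    (\<Prod>j\<in>{1..k}. 1 + (- 1) ^ \<eta> j * exp (- (x (d - k + j) * y (d - k + j) / t)))"
proof -
  define f where
    "f j e = e ^ \<eta> j * exp (- ((1 - e) * (x (d - k + j) * y (d - k + j)) / (2 * t)))"
    for j and e :: real
  have "chamber_kernel d k \<eta> t x y =
      (\<Sum>\<epsilon>\<in>sign_group k. gauss_kernel d t (vec_diff d x y) * (\<Prod>j\<in>{1..k}. f j (\<epsilon> j)))"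
    unfolding chamber_kernel_def
    by (intro sum.cong refl)
      (simp add: gauss_kernel_sign_act[OF assms] sign_char_def f_def prod.distrib ac_simps)
  also have "\<dots> = gauss_kernel d t (vec_diff d x y) *
      (\<Sum>\<epsilon>\<in>{1..k} \<rightarrow>\<^sub>E {1, - 1}. \<Prod>j\<in>{1..k}. f j (\<epsilon> j))"
    by (simp add: sum_distrib_left sign_group_def)
  also have "(\<Sum>\<epsilon>\<in>{1..k} \<rightarrow>\<^sub>E {1, - 1}. \<Prod>j\<in>{1..k}. f j (\<epsilon> j)) =
      (\<Prod>j\<in>{1..k}. \<Sum>e\<in>{1, - 1}. f j e)"
    by (rule prod_sum_PiE[symmetric]) auto
  also have "\<dots> = (\<Prod>j\<in>{1..k}. 1 + (- 1) ^ \<eta> j * exp (- (x (d - k + j) * y (d - k + j) / t)))"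
    by (intro prod.cong refl) (simp add: f_def)
  finally show ?thesis .
qed

text \<open>
  The lower bound is \<open>1 + u \<le> exp u\<close> in disguise; the upper bound is
  \<open>1 - exp (- u) \<le> min 1 u \<le> 2 u / (u + 1)\<close>.
\<close>

lemma one_minus_exp_bounds:
  fixes u :: real
  assumes "0 \<le> u"
  shows "u / (u + 1) \<le> 1 - exp (- u)" and "1 - exp (- u) \<le> 2 * (u / (u + 1))"
proof -
  have "exp (- u) \<le> inverse (u + 1)"
    unfolding exp_minus
    by (rule le_imp_inverse_le) (use assms exp_ge_add_one_self[of u] in \<open>auto simp: add.commute\<close>)
  then show "u / (u + 1) \<le> 1 - exp (- u)"
    using assms by (simp add: field_simps)
  show "1 - exp (- u) \<le> 2 * (u / (u + 1))"
  proof (cases "u \<le> 1")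
    case True
    have "1 - exp (- u) \<le> u" using exp_ge_add_one_self[of "- u"] by simp
    also have "u \<le> 2 * (u / (u + 1))"
      using True assms mult_left_mono[of u 1 u] by (simp add: field_simps)
    finally show ?thesis .
  next
    case False
    have "1 - exp (- u) \<le> 1" by simp
    also have "1 \<le> 2 * (u / (u + 1))" using False by (simp add: field_simps)
    finally show ?thesis .
  qed
qed

lemma boundary_factor_bounds:
  fixes s t :: real
  assumes "0 < s" and "0 < t" and "n \<in> {0, 1::nat}"
  shows "(if n = 1 then s / (s + t) else 1) \<le> 1 + (- 1) ^ n * exp (- (s / t))"
    and "1 + (- 1) ^ n * exp (- (s / t)) \<le> 2 * (if n = 1 then s / (s + t) else 1)"
proof -
  have u: "0 \<le> s / t" using assms by simp
  have q: "s / t / (s / t + 1) = s / (s + t)" using assms by (simp add: field_simps)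
  show "(if n = 1 then s / (s + t) else 1) \<le> 1 + (- 1) ^ n * exp (- (s / t))"
    and "1 + (- 1) ^ n * exp (- (s / t)) \<le> 2 * (if n = 1 then s / (s + t) else 1)"
    using assms(3) one_minus_exp_bounds[OF u, unfolded q] u by auto
qed

theorem proposition1p1:
  fixes d k :: nat and \<eta> :: "nat \<Rightarrow> nat"
  assumes "1 \<le> k" and "k \<le> d" and "\<eta> \<in> Z2_pow k"
  shows "\<exists>C::real. C > 0 \<and>
    (\<forall>t>0. \<forall>x\<in>chamber d k. \<forall>y\<in>chamber d k.
       inverse C * (gauss_kernel d t (vec_diff d x y) *
           (\<Prod>j\<in>(\<lambda>i. d - k + i) ` J_set k \<eta>. x j * y j / (x j * y j + t)))
         \<le> chamber_kernel d k \<eta> t x y \<and>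
       chamber_kernel d k \<eta> t x y
         \<le> C * (gauss_kernel d t (vec_diff d x y) *
           (\<Prod>j\<in>(\<lambda>i. d - k + i) ` J_set k \<eta>. x j * y j / (x j * y j + t))))"
proof (intro exI[of _ "2 ^ k"] conjI allI impI ballI)
  show "(0::real) < 2 ^ k" by simp
next
  fix t x y
  assume t: "0 < (t::real)" and x: "x \<in> chamber d k" and y: "y \<in> chamber d k"
  let ?P = "\<Prod>j\<in>(\<lambda>i. d - k + i) ` J_set k \<eta>. x j * y j / (x j * y j + t)"
  let ?G = "gauss_kernel d t (vec_diff d x y)"
  define s where "s j = x (d - k + j) * y (d - k + j)" for j
  define q where "q j = (if \<eta> j = 1 then s j / (s j + t) else 1)" for j
  define h where "h j = 1 + (- 1) ^ \<eta> j * exp (- (s j / t))" for j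
  have s: "0 < s j" if "j \<in> {1..k}" for j
    using x y that by (simp add: s_def chamber_def)
  have eta: "\<eta> j \<in> {0, 1}" if "j \<in> {1..k}" for j
    using assms(3) that unfolding Z2_pow_def by (rule PiE_mem)
  have q: "0 \<le> q j" "q j \<le> h j" "h j \<le> 2 * q j" if "j \<in> {1..k}" for j
    using boundary_factor_bounds[OF s[OF that] t eta[OF that]] s[OF that] t
    by (auto simp: q_def h_def)
  have "?P = (\<Prod>j\<in>J_set k \<eta>. s j / (s j + t))"
    by (subst prod.reindex) (simp_all add: s_def inj_on_def)
  also have "\<dots> = (\<Prod>j\<in>{1..k}. q j)"
    by (rule prod.mono_neutral_cong_left) (auto simp: q_def J_set_def)
  finally have P: "?P = (\<Prod>j\<in>{1..k}. q j)" .
  have K: "chamber_kernel d k \<eta> t x y = ?G * (\<Prod>j\<in>{1..k}. h j)"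
    by (simp add: chamber_kernel_factorization[OF assms(2)] h_def s_def)
  have G: "0 \<le> ?G" by (simp add: gauss_kernel_def)
  have P0: "0 \<le> ?P" unfolding P by (rule prod_nonneg) (use q in blast)
  have "?P \<le> (\<Prod>j\<in>{1..k}. h j)"
    unfolding P by (rule prod_mono) (use q in blast)
  then have lower: "?G * ?P \<le> chamber_kernel d k \<eta> t x y"
    unfolding K by (rule mult_left_mono) (rule G)
  have "inverse (2 ^ k) * (?G * ?P) \<le> 1 * (?G * ?P)"
    by (rule mult_right_mono) (use G P0 in \<open>simp_all add: field_simps\<close>)
  then show "inverse (2 ^ k) * (?G * ?P) \<le> chamber_kernel d k \<eta> t x y"
    using lower by simp
  have "(\<Prod>j\<in>{1..k}. h j) \<le> (\<Prod>j\<in>{1..k}. 2 * q j)"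
    by (rule prod_mono) (use q order_trans in blast)
  also have "\<dots> = 2 ^ k * ?P" unfolding P by (simp add: prod.distrib)
  finally have "?G * (\<Prod>j\<in>{1..k}. h j) \<le> ?G * (2 ^ k * ?P)"
    by (rule mult_left_mono) (rule G)
  then show "chamber_kernel d k \<eta> t x y \<le> 2 ^ k * (?G * ?P)"
    unfolding K by (simp add: mult.left_commute)
qed

end
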